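(* Let $L\ge2$, $n\ge1$ be integers, let $f_i(w)=\sum_{j\ge0}a^i_jw^j\in\mathbb{C}[\![w]\!]$ $(0\le i\le L-1)$ with $f_0(0)\ne0$, and let $(Q_j^{(i)}(w))_{0\le j\le L-1}$, for $0\le i\le L-1$, be the Hermite–Padé polynomials of $f_0,\dots,f_{L-1}$ (see the context). Then, for some normalizing (nonzero) constants ${\rm NQ}^{(i)}$ (independent of $j$), it holds for all $0\le i,j\le L-1$ that $$Q_j^{(i)}(w)=\frac{1}{{\rm NQ}^{(i)}}\det\left[\begin{array}{c}{\boldsymbol 0}\quad \overbrace{1,w,\dots,w^{n-1+\delta_{i,j}}}^{j\text{th block}}\quad {\boldsymbol 0}\\ \hline {\cal A}^{(i)}\end{array}\right],$$ where ${\cal A}^{(i)}$ is the $nL\times(nL+1)$ matrix $${\cal A}^{(i)}=\left[A^0_0(nL,n)\ \cdots\ A^{i-1}_0(nL,n)\ \ A^i_0(nL,n+1)\ \ A^{i+1}_{-1}(nL,n)\ \cdots\ A^{L-1}_{-1}(nL,n)\right],$$ and in the top row of the determinant the entries $1,w,\dots,w^{n-1+\delta_{i,j}}$ are placed in the columns of the $j$th block (blocks numbered $0,\dots,L-1$) and all other entries are zero.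
   Context: $\delta_{i,j}$ is the Kronecker delta. $A^i_j(k,l)$ denotes the $k\times l$ rectangular Toeplitz matrix whose $(r,s)$ entry is $a^i_{j+r-s}$ $(1\le r\le k,\ 1\le s\le l)$, with $a^i_j=0$ for $j<0$ (the superscript $i$ is an index). For each $0\le i\le L-1$, $(Q^{(i)}_j)_{0\le j\le L-1}$ is a nontrivial tuple of polynomials in $w$ with $\deg Q^{(i)}_j\le n-1+\delta_{i,j}$ and $$Q_0^{(i)}f_0+\cdots+Q_i^{(i)}f_i+wQ_{i+1}^{(i)}f_{i+1}+\cdots+wQ_{L-1}^{(i)}f_{L-1}=O(w^{nL}).$$ It is always assumed that ${\cal A}^{(i)}$ has rank $nL$, equivalently that this tuple is unique up to simultaneous multiplication by constants. *)

theory Defs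
  imports
    "HOL-Computational_Algebra.Polynomial_FPS"
    "Jordan_Normal_Form.DL_Rank"
begin

definition append_cols :: "'a :: zero mat \<Rightarrow> 'a mat \<Rightarrow> 'a mat" (infixr \<open>@\<^sub>c\<close> 65) where
  "A @\<^sub>c B = four_block_mat A B (0\<^sub>m 0 (dim_col A)) (0\<^sub>m 0 (dim_col B))"

definition block_row :: "nat \<Rightarrow> 'a :: zero mat list \<Rightarrow> 'a mat" where
  "block_row m Bs = foldr append_cols Bs (0\<^sub>m m 0)"

(* The k x l matrix with (r,s) entry a_{j+r-s}, where a_m is the coefficient of w^m in f and
   a_m = 0 for m < 0. Only r - s enters, so indexing rows and columns from 0 makes no difference. *)
definition toeplitz_mat :: "'a :: zero fps \<Rightarrow> int \<Rightarrow> nat \<Rightarrow> nat \<Rightarrow> 'a mat" where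
  "toeplitz_mat f j k l =
     mat k l (\<lambda>(r, s). let m = j + int r - int s in if m < 0 then 0 else fps_nth f (nat m))"

definition HP_matrix :: "nat \<Rightarrow> nat \<Rightarrow> (nat \<Rightarrow> complex fps) \<Rightarrow> nat \<Rightarrow> complex mat" where
  "HP_matrix L n f i = block_row (n * L)
     (map (\<lambda>k. toeplitz_mat (f k) (if k \<le> i then 0 else - 1) (n * L) (n + of_bool (k = i)))
       [0..<L])"

(* Block k has width n + [k = i]; block j carries 1, w, ..., w^(n - 1 + [i = j]). *)
definition HP_top_row :: "nat \<Rightarrow> nat \<Rightarrow> nat \<Rightarrow> nat \<Rightarrow> complex poly mat" where
  "HP_top_row L n i j = block_row 1
     (map (\<lambda>k. if k = j then mat 1 (n + of_bool (k = i)) (\<lambda>(_, s). monom 1 s)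
               else 0\<^sub>m 1 (n + of_bool (k = i)))
       [0..<L])"

definition HP_det :: "nat \<Rightarrow> nat \<Rightarrow> (nat \<Rightarrow> complex fps) \<Rightarrow> nat \<Rightarrow> nat \<Rightarrow> complex poly" where
  "HP_det L n f i j =
     det (HP_top_row L n i j @\<^sub>r map_mat (\<lambda>c. [:c:]) (HP_matrix L n f i))"

(* F = O(w^N) for formal power series *)
definition fps_bigo :: "nat \<Rightarrow> 'a :: zero fps \<Rightarrow> bool" where
  "fps_bigo N F \<longleftrightarrow> (\<forall>m<N. fps_nth F m = 0)"

(* Q j stands for Q_j^(i). Since degree 0 = 0 in the library and the bound is nonnegative for
   n >= 1, vanishing components are allowed, as long as not all of them vanish. *)
definition HP_polys ::
    "nat \<Rightarrow> nat \<Rightarrow> (nat \<Rightarrow> complex fps) \<Rightarrow> nat \<Rightarrow> (nat \<Rightarrow> complex poly) \<Rightarrow> bool" where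
  "HP_polys L n f i Q \<longleftrightarrow>
     (\<exists>j<L. Q j \<noteq> 0) \<and>
     (\<forall>j<L. degree (Q j) \<le> n - 1 + of_bool (i = j)) \<and>
     fps_bigo (n * L)
       ((\<Sum>j\<in>{0..i}. fps_of_poly (Q j) * f j) +
        (\<Sum>j\<in>{i<..<L}. fps_X * fps_of_poly (Q j) * f j))"

end

theory Submission
  imports Defs
begin

text \<open>
  Comparing coefficients, the order condition says that the concatenated coefficient vector
  of the $Q_j^{(i)}$ lies in the kernel of ${\cal A}^{(i)}$. The signed maximal minors of
  ${\cal A}^{(i)}$ also form a kernel vector (repeat a row of the matrix and expand the determinant
  along the extra copy), and by the rank condition it is nonzero and the kernel is a line. So
  the two vectors are proportional, and the Laplace expansion along the top row turns the minors
  into the coefficients of the determinants.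
\<close>

section \<open>Kernels of matrices of corank one\<close>

text \<open>Maximal minors of a wide matrix drop a column and no row, which
  \<open>mat_delete\<close> does not offer; \<open>insert_index c\<close> enumerates the indices
  other than \<open>c\<close>.\<close>

definition delete_col :: "'a mat \<Rightarrow> nat \<Rightarrow> 'a mat" where
  "delete_col A c = mat (dim_row A) (dim_col A - 1) (\<lambda>(r, s). A $$ (r, insert_index c s))"

lemma delete_col_carrier: "A \<in> carrier_mat m (Suc k) \<Longrightarrow> delete_col A c \<in> carrier_mat m k"
  by (auto simp: delete_col_def)

lemma mat_delete_append_row:
  assumes "R \<in> carrier_mat 1 (Suc N)" "A \<in> carrier_mat N (Suc N)"
  shows "mat_delete (R @\<^sub>r A) 0 c = delete_col A c"
  using assms
  by (intro eq_matI) (auto simp: mat_delete_def delete_col_def append_rows_def insert_index_def)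

text \<open>Laplace expansion along the added row. It serves twice: with a repeated row of the
  matrix, and with the row of monomials of the theorem.\<close>

lemma det_append_row:
  fixes A :: "'a :: comm_ring_1 mat"
  assumes R: "R \<in> carrier_mat 1 (Suc N)" and A: "A \<in> carrier_mat N (Suc N)"
  shows "det (R @\<^sub>r A) = (\<Sum>c<Suc N. R $$ (0, c) * ((- 1) ^ c * det (delete_col A c)))"
proof -
  have M: "R @\<^sub>r A \<in> carrier_mat (Suc N) (Suc N)"
    using carrier_append_rows[OF R A] by simp
  have "(R @\<^sub>r A) $$ (0, c) = R $$ (0, c)" if "c < Suc N" for c
    using R A that by (simp add: append_rows_def)
  then show ?thesis
    unfolding laplace_expansion_row[OF M zero_less_Suc] cofactor_def mat_delete_append_row[OF R A]
    by (intro sum.cong) auto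
qed

lemma signed_minors_in_kernel:
  fixes A :: "'a :: comm_ring_1 mat"
  assumes A: "A \<in> carrier_mat N (Suc N)" and r: "r < N"
  shows "(\<Sum>c<Suc N. A $$ (r, c) * ((- 1) ^ c * det (delete_col A c))) = 0"
proof -
  define R where "R = mat 1 (Suc N) (\<lambda>(_, c). A $$ (r, c))"
  have R: "R \<in> carrier_mat 1 (Suc N)"
    by (simp add: R_def)
  have M: "R @\<^sub>r A \<in> carrier_mat (Suc N) (Suc N)"
    using carrier_append_rows[OF R A] by simp
  have "row (R @\<^sub>r A) 0 = row (R @\<^sub>r A) (Suc r)"
    using A r by (intro eq_vecI) (auto simp: append_rows_def R_def)
  then have "det (R @\<^sub>r A) = 0"
    using det_identical_rows[OF M, of 0 "Suc r"] r by simp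
  then show ?thesis
    unfolding det_append_row[OF R A] by (simp add: R_def)
qed

text \<open>Full row rank provides N independent columns out of N + 1, so exactly one index is left
  over; deleting that column leaves an invertible square matrix.\<close>

lemma exists_nonzero_minor:
  fixes A :: "'a :: field mat"
  assumes A: "A \<in> carrier_mat N (Suc N)" and rk: "vec_space.rank N A = N"
  obtains c where "c < Suc N" "det (delete_col A c) \<noteq> 0"
proof -
  interpret vec_space "TYPE('a)" N .
  obtain S where S: "maximal S (\<lambda>T. T \<subseteq> set (cols A) \<and> lin_indpt T)"
    using maximal_exists_superset
        [where P = "\<lambda>T. T \<subseteq> set (cols A) \<and> lin_indpt T" and S = "set (cols A)" and B = "{}"]
    by (auto simp: lin_dep_def)
  have cardS: "card S = N"
    using rank_card_indpt[OF A S] rk by simp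
  have sub: "S \<subseteq> col A ` {..<Suc N}" and ind: "lin_indpt S"
    using S A by (simp_all add: maximal_def cols_def lessThan_Suc atLeast0LessThan)
  \<comment> \<open>\<open>S\<close> is a set of vectors, in which equal columns coincide. Choosing
    one index per vector makes it possible to count indices.\<close>
  obtain J where J: "J \<subseteq> {..<Suc N}" "S = col A ` J" "inj_on (col A) J"
    using sub subset_image_inj[of S "col A" "{..<Suc N}"] by auto
  have cardJ: "card J = N"
    using J cardS card_image by metis
  have "J \<noteq> {..<Suc N}"
    by (metis cardJ card_lessThan n_not_Suc_n)
  then obtain c where c: "c < Suc N" "c \<notin> J"
    using J by auto
  have "J = {..<Suc N} - {c}"
    using J c cardJ by (intro card_subset_eq) auto
  then have img: "insert_index c ` {0..<N} = J"
    using insert_index_image[OF c(1)] by (simp add: atLeast0LessThan)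
  let ?B = "delete_col A c"
  have B: "?B \<in> carrier_mat N N"
    by (rule delete_col_carrier[OF A])
  have "col ?B s = col A (insert_index c s)" if "s < N" for s
    using A that c by (intro eq_vecI) (auto simp: delete_col_def insert_index_def)
  then have cols: "cols ?B = map (col A) (map (insert_index c) [0..<N])"
    using B by (simp add: cols_def)
  have "set (cols ?B) = S"
    unfolding cols J(2) img[symmetric] by (simp add: image_image)
  \<comment> \<open>Independence of the set of columns does not detect repetitions; injectivity of
    \<open>col A\<close> on \<open>J\<close> excludes them.\<close>
  moreover have "distinct (cols ?B)"
    unfolding cols distinct_map using img J(3) by (simp add: insert_index_inj_on)
  ultimately have "rank ?B = N"
    using lin_indpt_full_rank[OF B] ind by simp
  then show thesis
    using that c det_rank_iff[OF B] by simp
qed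

text \<open>Subtract from \<open>q\<close> the multiple of the minor vector that cancels coordinate
  \<open>d\<close>, where minor \<open>d\<close> is nonzero. The difference is still in the kernel
  and involves only the other columns, which form an invertible matrix, so it vanishes.\<close>

lemma kernel_eq_signed_minors:
  fixes A :: "'a :: field mat"
  assumes A: "A \<in> carrier_mat N (Suc N)" and rk: "vec_space.rank N A = N"
    and ker: "\<And>r. r < N \<Longrightarrow> (\<Sum>c<Suc N. A $$ (r, c) * q c) = 0"
    and nz: "\<exists>c<Suc N. q c \<noteq> 0"
  obtains t where "t \<noteq> 0" "\<And>c. c < Suc N \<Longrightarrow> q c = t * ((- 1) ^ c * det (delete_col A c))"
proof -
  define v where "v c = (- 1) ^ c * det (delete_col A c)" for c
  obtain d where d: "d < Suc N" "det (delete_col A d) \<noteq> 0"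
    by (rule exists_nonzero_minor[OF A rk])
  then have vd: "v d \<noteq> 0"
    by (simp add: v_def)
  define t where "t = q d / v d"
  define u where "u c = q c - t * v c" for c
  have ud: "u d = 0"
    using vd by (simp add: u_def t_def)
  let ?B = "delete_col A d" and ?x = "vec N (\<lambda>s. u (insert_index d s))"
  have B: "?B \<in> carrier_mat N N"
    by (rule delete_col_carrier[OF A])
  have "?B *\<^sub>v ?x = 0\<^sub>v N"
  proof (rule eq_vecI)
    fix r assume "r < dim_vec (0\<^sub>v N :: 'a vec)"
    then have r: "r < N"
      by simp
    have "(?B *\<^sub>v ?x) $ r = (\<Sum>s\<in>{0..<N}. A $$ (r, insert_index d s) * u (insert_index d s))"
      using A r by (simp add: delete_col_def scalar_prod_def)
    also have "\<dots> = (\<Sum>c\<in>{0..<Suc N} - {d}. A $$ (r, c) * u c)"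
      unfolding insert_index_image[OF d(1), symmetric]
      by (simp add: sum.reindex[OF insert_index_inj_on])
    \<comment> \<open>The missing column \<open>d\<close> can be restored because
      \<open>u d = 0\<close>.\<close>
    also have "\<dots> = (\<Sum>c<Suc N. A $$ (r, c) * u c)"
      using ud by (intro sum.mono_neutral_left) auto
    also have "\<dots> = (\<Sum>c<Suc N. A $$ (r, c) * q c) - t * (\<Sum>c<Suc N. A $$ (r, c) * v c)"
      unfolding u_def by (simp only: right_diff_distrib sum_subtractf sum_distrib_left mult.left_commute)
    also have "\<dots> = 0"
      using ker[OF r] signed_minors_in_kernel[OF A r] unfolding v_def by simp
    finally show "(?B *\<^sub>v ?x) $ r = 0\<^sub>v N $ r"
      using r by simp
  qed (use B in simp)
  then have x0: "?x = 0\<^sub>v N"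
    using det_0_iff_vec_prod_zero_field[OF B] d(2) vec_carrier by blast
  have u0: "u c = 0" if "c < Suc N" for c
  proof (cases "c = d")
    case False
    then have "c \<in> insert_index d ` {0..<N}"
      using that insert_index_image[OF d(1)] by simp
    then obtain s where s: "s < N" "c = insert_index d s"
      by auto
    then show ?thesis
      using arg_cong[OF x0, of "\<lambda>x. x $ s"] by simp
  qed (simp add: ud)
  then have q: "q c = t * v c" if "c < Suc N" for c
    using that by (simp add: u_def)
  then have "t \<noteq> 0"
    using nz by auto
  then show thesis
    using q that unfolding v_def by blast
qed

section \<open>Block rows\<close>

lemma append_cols_carrier:
  assumes "A \<in> carrier_mat m a" "B \<in> carrier_mat m b"
  shows "A @\<^sub>c B \<in> carrier_mat m (a + b)"
  using assms by (auto simp: append_cols_def)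

lemma append_cols_index:
  assumes "A \<in> carrier_mat m a" "B \<in> carrier_mat m b" "r < m" "c < a + b"
  shows "(A @\<^sub>c B) $$ (r, c) = (if c < a then A $$ (r, c) else B $$ (r, c - a))"
  using assms by (auto simp: append_cols_def)

lemma block_row_Nil: "block_row m [] = 0\<^sub>m m 0"
  and block_row_Cons: "block_row m (B # Bs) = B @\<^sub>c block_row m Bs"
  by (simp_all add: block_row_def)

lemma block_row_carrier_list:
  assumes "\<And>B. B \<in> set Bs \<Longrightarrow> dim_row B = m"
  shows "block_row m Bs \<in> carrier_mat m (sum_list (map dim_col Bs))"
  using assms
proof (induction Bs)
  case (Cons B Bs)
  then show ?case
    unfolding block_row_Cons list.map sum_list.Cons by (intro append_cols_carrier) auto
qed (simp add: block_row_Nil)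

lemma block_row_index_list:
  assumes "\<And>B. B \<in> set Bs \<Longrightarrow> dim_row B = m" "k < length Bs" "s < dim_col (Bs ! k)" "r < m"
  shows "block_row m Bs $$ (r, sum_list (map dim_col (take k Bs)) + s) = Bs ! k $$ (r, s)"
  using assms
proof (induction Bs arbitrary: k)
  case (Cons B Bs)
  have B: "B \<in> carrier_mat m (dim_col B)"
    using Cons.prems(1) by auto
  have C: "block_row m Bs \<in> carrier_mat m (sum_list (map dim_col Bs))"
    using Cons.prems(1) by (intro block_row_carrier_list) auto
  note idx = append_cols_index[OF B C \<open>r < m\<close>]
  show ?case
  proof (cases k)
    case 0
    then show ?thesis
      using Cons.prems by (simp add: block_row_Cons idx)
  next
    case (Suc l)
    \<comment> \<open>Splitting the total width at block \<open>l\<close> shows that the column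
      index stays inside the tail, as \<open>idx\<close> requires.\<close>
    have "sum_list (map dim_col Bs)
        = sum_list (map dim_col (take l Bs)) + sum_list (map dim_col (drop l Bs))"
      by (metis append_take_drop_id map_append sum_list_append)
    moreover have "dim_col (Bs ! l) \<le> sum_list (map dim_col (drop l Bs))"
      using Cons.prems(2) Suc by (simp add: Cons_nth_drop_Suc[symmetric])
    ultimately have "sum_list (map dim_col (take l Bs)) + s < sum_list (map dim_col Bs)"
      using Cons.prems(3) Suc by simp
    then show ?thesis
      using Cons Suc by (simp add: block_row_Cons idx add.assoc)
  qed
qed simp

lemma block_row_carrier:
  assumes "\<And>k. k < L \<Longrightarrow> B k \<in> carrier_mat m (w k)"
  shows "block_row m (map B [0..<L]) \<in> carrier_mat m (\<Sum>k<L. w k)"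
proof -
  have "sum_list (map dim_col (map B [0..<L])) = (\<Sum>k<L. w k)"
    using assms unfolding map_map interv_sum_list_conv_sum_set_nat
    by (intro sum.cong) fastforce+
  then show ?thesis
    using block_row_carrier_list[of "map B [0..<L]" m] assms by fastforce
qed

lemma block_row_index:
  assumes "\<And>k. k < L \<Longrightarrow> B k \<in> carrier_mat m (w k)" "k < L" "s < w k" "r < m"
  shows "block_row m (map B [0..<L]) $$ (r, (\<Sum>l<k. w l) + s) = B k $$ (r, s)"
proof -
  have dim: "dim_col (B l) = w l" if "l < L" for l
    using assms(1)[OF that] by simp
  then have "sum_list (map dim_col (take k (map B [0..<L]))) = (\<Sum>l<k. w l)"
    using assms(2) by (simp add: take_map interv_sum_list_conv_sum_set_nat atLeast0LessThan)
  moreover have "dim_row X = m" if "X \<in> set (map B [0..<L])" for X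
    using that assms(1) by fastforce
  ultimately show ?thesis
    using block_row_index_list[of "map B [0..<L]" m k s r] assms(2-4) dim by simp
qed

text \<open>Passes from global column numbers to pairs of a block and a position in it, matching the
  indexing of \<open>block_row_index\<close>.\<close>

lemma sum_lessThan_blocks:
  fixes g :: "nat \<Rightarrow> 'a :: comm_monoid_add" and w :: "nat \<Rightarrow> nat"
  shows "(\<Sum>c<(\<Sum>k<L. w k). g c) = (\<Sum>k<L. \<Sum>s<w k. g ((\<Sum>l<k. w l) + s))"
proof (induction L)
  case (Suc L)
  have "(\<Sum>c<a + b. g c) = (\<Sum>c<a. g c) + (\<Sum>s<b. g (a + s))" for a b :: nat
    by (induction b) (simp_all add: add.assoc)
  then show ?case
    using Suc by simp
qed simp

section \<open>The linear system of the Hermite--Pade polynomials\<close>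

text \<open>A Toeplitz matrix acts on coefficient vectors as the Cauchy product with
  \<open>f\<close>, and lowering its index by \<open>e\<close> delays the result by \<open>e\<close>
  places. The values e = 0 and e = 1 give the two kinds of blocks.\<close>

lemma toeplitz_mat_mult:
  fixes f :: "'a :: comm_ring_1 fps"
  assumes "degree p < l" "r < k"
  shows "(\<Sum>s<l. toeplitz_mat f (- int e) k l $$ (r, s) * coeff p s)
    = fps_nth (fps_X ^ e * (fps_of_poly p * f)) r"
proof -
  have "(\<Sum>s<l. toeplitz_mat f (- int e) k l $$ (r, s) * coeff p s)
      = (\<Sum>s<l. if s + e \<le> r then coeff p s * fps_nth f (r - e - s) else 0)"
    using assms(2) by (intro sum.cong) (auto simp: toeplitz_mat_def nat_diff_distrib' nat_add_distrib
      algebra_simps Let_def intro!: arg_cong[where f = "fps_nth f"])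
  also have "\<dots> = (if r < e then 0 else \<Sum>s=0..r - e. coeff p s * fps_nth f (r - e - s))"
  proof (cases "r < e")
    case False
    have "(\<Sum>s<l. if s + e \<le> r then coeff p s * fps_nth f (r - e - s) else 0)
        = (\<Sum>s\<in>{0..r - e} \<inter> {..<l}. coeff p s * fps_nth f (r - e - s))"
      using False by (subst sum.inter_filter[symmetric]) (auto intro!: sum.cong)
    \<comment> \<open>The cut at \<open>l\<close> loses nothing, since all coefficients of
      \<open>p\<close> from \<open>l\<close> on are zero.\<close>
    also have "\<dots> = (\<Sum>s=0..r - e. coeff p s * fps_nth f (r - e - s))"
      using assms(1) by (intro sum.mono_neutral_left) (auto intro!: le_less_trans[OF le_degree[of p]])
    finally show ?thesis
      using False by simp
  qed simp
  finally show ?thesis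
    unfolding fps_X_power_mult_nth by (simp add: fps_mult_nth)
qed

text \<open>The factor comes from comparing whole kernel vectors, across all blocks at once; hence a
  single \<open>t\<close> serves every \<open>j\<close>.\<close>

lemma HP_det_eq_multiple:
  assumes n: "n \<ge> 1" and i: "i < L"
    and rk: "vec_space.rank (n * L) (HP_matrix L n f i) = n * L"
    and HP: "HP_polys L n f i Q"
  shows "\<exists>t. t \<noteq> 0 \<and> (\<forall>j<L. Q j = Polynomial.smult t (HP_det L n f i j))"
proof -
  define w where "w k = n + of_bool (k = i)" for k
  define N where "N = n * L"
  define A where "A = HP_matrix L n f i"
  define e :: "nat \<Rightarrow> nat" where "e k = of_bool (i < k)" for k
  define T where "T k = toeplitz_mat (f k) (- int (e k)) N (w k)" for k
  \<comment> \<open>The coefficients of the \<open>Q k\<close>, padded to the block widths and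
    joined into one vector \<open>q\<close>; building it as a block row gives it the same column
    numbering as \<open>A\<close>.\<close>
  define X where "X k = mat 1 (w k) (\<lambda>(_, s). coeff (Q k) s)" for k
  define q where "q c = block_row 1 (map X [0..<L]) $$ (0, c)" for c
  \<comment> \<open>Each block contributes \<open>n\<close> columns, and block \<open>i\<close> one
    more.\<close>
  have wsum: "(\<Sum>k<L. w k) = Suc N"
    using i by (simp add: w_def sum.distrib N_def of_bool_def mult.commute)
  have T: "T k \<in> carrier_mat N (w k)" for k
    by (simp add: T_def toeplitz_mat_def)
  have A_eq: "A = block_row N (map T [0..<L])"
    unfolding A_def HP_matrix_def N_def T_def w_def e_def
    by (intro arg_cong[where f = "block_row (n * L)"] map_cong) auto
  have A: "A \<in> carrier_mat N (Suc N)"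
    unfolding A_eq wsum[symmetric] by (rule block_row_carrier) (rule T)
  have AT: "A $$ (r, (\<Sum>l<k. w l) + s) = T k $$ (r, s)" if "k < L" "s < w k" "r < N" for k s r
    unfolding A_eq using that by (intro block_row_index T)
  have q: "q ((\<Sum>l<k. w l) + s) = coeff (Q k) s" if "k < L" "s < w k" for k s
    unfolding q_def using block_row_index[of L X 1 w k s 0] that by (simp add: X_def)
  \<comment> \<open>Here \<open>n \<ge> 1\<close> keeps the truncated subtraction
    \<open>n - 1\<close> honest, so every coefficient of \<open>Q k\<close> fits into its
    block.\<close>
  have deg: "degree (Q k) < w k" if "k < L" for k
    using HP that n unfolding HP_polys_def w_def by (fastforce simp: of_bool_def split: if_splits)
  have ker: "(\<Sum>c<Suc N. A $$ (r, c) * q c) = 0" if r: "r < N" for r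
  proof -
    have "(\<Sum>c<Suc N. A $$ (r, c) * q c) = (\<Sum>k<L. \<Sum>s<w k. T k $$ (r, s) * coeff (Q k) s)"
      unfolding wsum[symmetric] sum_lessThan_blocks using r by (intro sum.cong) (auto simp: AT q)
    also have "\<dots> = (\<Sum>k<L. fps_nth (fps_X ^ e k * (fps_of_poly (Q k) * f k)) r)"
      unfolding T_def using r deg by (intro sum.cong toeplitz_mat_mult) auto
    also have "\<dots> = fps_nth (\<Sum>k<L. fps_X ^ e k * (fps_of_poly (Q k) * f k)) r"
      by (simp add: fps_sum_nth)
    \<comment> \<open>Split at \<open>i\<close>, where the exponent \<open>e k\<close> jumps from 0
      to 1; this recovers the two sums of the order condition.\<close>
    also have "(\<Sum>k<L. fps_X ^ e k * (fps_of_poly (Q k) * f k))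
        = (\<Sum>k\<in>{0..i}. fps_X ^ e k * (fps_of_poly (Q k) * f k))
        + (\<Sum>k\<in>{i<..<L}. fps_X ^ e k * (fps_of_poly (Q k) * f k))"
      using i by (subst sum.union_disjoint[symmetric]) (auto intro!: sum.cong)
    also have "\<dots> = (\<Sum>k\<in>{0..i}. fps_of_poly (Q k) * f k)
        + (\<Sum>k\<in>{i<..<L}. fps_X * fps_of_poly (Q k) * f k)"
      by (simp add: e_def mult.assoc)
    also have "fps_nth \<dots> r = 0"
      using HP r unfolding HP_polys_def fps_bigo_def N_def by blast
    finally show ?thesis .
  qed
  have bound: "(\<Sum>l<k. w l) + s < Suc N" if "k < L" "s < w k" for k s
  proof -
    have "(\<Sum>l<Suc k. w l) \<le> (\<Sum>l<L. w l)"
      using that by (intro sum_mono2) auto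
    then show ?thesis
      using that wsum by simp
  qed
  obtain j where j: "j < L" "Q j \<noteq> 0"
    using HP unfolding HP_polys_def by blast
  \<comment> \<open>The leading coefficient of a nonzero component is a nonzero entry of
    \<open>q\<close>.\<close>
  then have "q ((\<Sum>l<j. w l) + degree (Q j)) \<noteq> 0"
    using q deg by simp
  then have "\<exists>c<Suc N. q c \<noteq> 0"
    using bound deg j by blast
  then obtain t where t: "t \<noteq> 0"
    and qt: "\<And>c. c < Suc N \<Longrightarrow> q c = t * ((- 1) ^ c * det (delete_col A c))"
    using kernel_eq_signed_minors[OF A _ ker] rk unfolding A_def N_def by metis
  have "Q j = Polynomial.smult t (HP_det L n f i j)" if j: "j < L" for j
  proof -
    define R :: "nat \<Rightarrow> complex poly mat" where
      "R k = (if k = j then mat 1 (w k) (\<lambda>(_, s). monom 1 s) else 0\<^sub>m 1 (w k))" for k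
    define v where "v c = (- 1) ^ c * det (delete_col A c)" for c
    have R: "R k \<in> carrier_mat 1 (w k)" for k
      by (simp add: R_def)
    have top_eq: "HP_top_row L n i j = block_row 1 (map R [0..<L])"
      unfolding HP_top_row_def R_def w_def ..
    have top: "HP_top_row L n i j \<in> carrier_mat 1 (Suc N)"
      unfolding top_eq wsum[symmetric] by (rule block_row_carrier) (rule R)
    have idx: "HP_top_row L n i j $$ (0, (\<Sum>l<k. w l) + s) = (if k = j then monom 1 s else 0)"
      if "k < L" "s < w k" for k s
      unfolding top_eq using block_row_index[of L R 1 w k s 0] R that by (auto simp: R_def)
    \<comment> \<open>Constants embed as a ring homomorphism, so the minors of the matrix of
      constant polynomials are the constant polynomials of the minors of \<open>A\<close>.\<close>
    interpret const: comm_ring_hom "\<lambda>c :: complex. [:c:]"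
      by unfold_locales (auto simp: one_pCons)
    let ?A = "map_mat (\<lambda>c. [:c:]) A"
    have cA: "?A \<in> carrier_mat N (Suc N)"
      using A by simp
    have "delete_col ?A c = map_mat (\<lambda>c. [:c:]) (delete_col A c)" if "c < Suc N" for c
      using A that by (intro eq_matI) (auto simp: delete_col_def insert_index_def)
    then have dc: "(- 1) ^ c * det (delete_col ?A c) = [:v c:]" if "c < Suc N" for c
      using that unfolding v_def by (simp add: const.hom_mult const.hom_power const.hom_uminus)
    have "HP_det L n f i j = (\<Sum>c<Suc N. HP_top_row L n i j $$ (0, c) * [:v c:])"
      unfolding HP_det_def A_def[symmetric] det_append_row[OF top cA]
      by (intro sum.cong refl) (simp only: dc lessThan_iff)
    \<comment> \<open>Only block \<open>j\<close> of the top row is nonzero, so the determinant is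
      the polynomial whose coefficients are the signed minors of that block.\<close>
    also have "\<dots> = (\<Sum>k<L. \<Sum>s<w k. if k = j then monom (v ((\<Sum>l<k. w l) + s)) s else 0)"
      unfolding wsum[symmetric] sum_lessThan_blocks
      by (intro sum.cong refl) (auto simp: idx smult_monom)
    also have "\<dots> = (\<Sum>k<L. if k = j then \<Sum>s<w k. monom (v ((\<Sum>l<k. w l) + s)) s else 0)"
      by (intro sum.cong) auto
    also have "\<dots> = (\<Sum>s<w j. monom (v ((\<Sum>l<j. w l) + s)) s)"
      using j by simp
    finally have det: "HP_det L n f i j = \<dots>" .
    show ?thesis
    proof (rule poly_eqI)
      fix s
      show "coeff (Q j) s = coeff (Polynomial.smult t (HP_det L n f i j)) s"
      proof (cases "s < w j")
        case True
        then have "coeff (Q j) s = t * v ((\<Sum>l<j. w l) + s)"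
          using q[OF j True] qt[OF bound[OF j True]] by (simp add: v_def)
        then show ?thesis
          using True by (simp add: det coeff_sum)
      next
        \<comment> \<open>Beyond the block width both polynomials have coefficient zero.\<close>
        case False
        then show ?thesis
          using deg[OF j] by (simp add: det coeff_sum coeff_eq_0)
      qed
    qed
  qed
  then show ?thesis
    using t by blast
qed

theorem proposition2p1:
  fixes L n :: nat
    and f :: "nat \<Rightarrow> complex fps"
    and Q :: "nat \<Rightarrow> nat \<Rightarrow> complex poly"
  assumes "L \<ge> 2" and "n \<ge> 1"
    and "fps_nth (f 0) 0 \<noteq> 0"
    and "\<forall>i<L. vec_space.rank (n * L) (HP_matrix L n f i) = n * L"
    and "\<forall>i<L. HP_polys L n f i (Q i)"
  shows "\<exists>NQ :: nat \<Rightarrow> complex. (\<forall>i<L. NQ i \<noteq> 0) \<and>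
           (\<forall>i<L. \<forall>j<L. Q i j = Polynomial.smult (1 / NQ i) (HP_det L n f i j))"
proof -
  have "\<forall>i. \<exists>t. i < L \<longrightarrow> t \<noteq> 0 \<and> (\<forall>j<L. Q i j = Polynomial.smult t (HP_det L n f i j))"
    using HP_det_eq_multiple assms(2,4,5) by blast
  then obtain t where
    "\<And>i. i < L \<Longrightarrow> t i \<noteq> 0 \<and> (\<forall>j<L. Q i j = Polynomial.smult (t i) (HP_det L n f i j))"
    by metis
  then show ?thesis
    \<comment> \<open>The theorem divides by the normalizing constant, which is therefore the
      reciprocal of the factor \<open>t i\<close>.\<close>
    by (intro exI[of _ "\<lambda>i. 1 / t i"]) simp
qed

end
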